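(* Let $k$ be a positive integer and let $I=\{1,2,\dots,k\}$. For each $i\in I$ let $a_i$ be a nonnegative integer, and let $A$ be the multiset $\{a_i : i\in I\}$. Let $\mathrm{sums}(A)$ be the multiset $\{\sum_{i\in J} a_i : J\subseteq I\}$, which has exactly $2^k$ entries (one for each subset $J$, counted with multiplicity). Let $S$ be the multiset $\{k+x : x\in \mathrm{sums}(A)\}$, let $n=|S|=2^k$ and $m=\max(S)=k+\sum_{i=1}^k a_i$. Then there exists a poset of cardinality $m+\log_2(n)=2k+\sum_{i=1}^k a_i$ whose multiset of maximal chain cardinalities equals $S$.
   Context: A chain in a poset is a subset any two elements of which are comparable; a chain is maximal if it is not properly contained in any other chain. The multiset of maximal chain cardinalities of a finite poset contains one entry $|C|$ for each maximal chain $C$. *)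

theory Defs
  imports Complex_Main "HOL-Library.Multiset"
begin

text \<open>The carrier \<open>X\<close> is meant to be finite: \<^const>\<open>mset_set\<close> yields the empty multiset on an infinite set.\<close>
definition maxchain_cards :: "'a set \<Rightarrow> 'a rel \<Rightarrow> nat multiset"
  where "maxchain_cards X r =
    image_mset card (mset_set {C. pred_on.maxchain X (\<lambda>x y. (x, y) \<in> r) C})"

text \<open>The multiset is indexed by subsets of the index set, not by submultisets of the values.\<close>
definition subset_sums :: "'i set \<Rightarrow> ('i \<Rightarrow> nat) \<Rightarrow> nat multiset"
  where "subset_sums I a = image_mset (\<lambda>J. \<Sum>i\<in>J. a i) (mset_set (Pow I))"

end

theory Submission
  imports Defs "HOL-Library.Nat_Bijection"
begin

text \<open>
  Take the ordinal sum of \<open>k\<close> blocks, where block \<open>i\<close> is the disjoint union of a chain with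
  \<open>a\<^sub>i + 1\<close> elements and a single point. A maximal chain chooses in each block either the long
  chain or the point; if \<open>J\<close> is the set of blocks where it takes the long chain, then it has
  \<open>k + (\<Sum>i\<in>J. a\<^sub>i)\<close> elements. The poset itself has \<open>\<Sum>i. (a\<^sub>i + 2)\<close> elements.
\<close>

text \<open>
  An element is identified by its block \<open>b x\<close> and its height \<open>h x\<close>, where height \<open>0\<close> encodes the
  isolated point of the block and the heights \<open>1, \<dots>, a i + 1\<close> form the long chain.
\<close>
locale block_sum =
  fixes X :: "'x set" and I :: "'i::linorder set" and a :: "'i \<Rightarrow> nat"
    and b :: "'x \<Rightarrow> 'i" and h :: "'x \<Rightarrow> nat"
  assumes finite_index: "finite I"
    and bij_coords: "bij_betw (\<lambda>x. (b x, h x)) X (SIGMA i:I. {..Suc (a i)})"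
begin

text \<open>The guard \<open>0 < h x\<close> keeps the point at height 0 incomparable to the long
  chain of its block; the disjunct \<open>x = y\<close> restores reflexivity there.\<close>

definition order :: "'x rel" where
  "order = {(x, y). x \<in> X \<and> y \<in> X \<and>
     (b x < b y \<or> b x = b y \<and> (x = y \<or> 0 < h x \<and> h x \<le> h y))}"

definition selection :: "'i set \<Rightarrow> 'x set" where
  "selection J = {x \<in> X. 0 < h x \<longleftrightarrow> b x \<in> J}"

lemma coords_inject: "x \<in> X \<Longrightarrow> y \<in> X \<Longrightarrow> b x = b y \<Longrightarrow> h x = h y \<Longrightarrow> x = y"
  using bij_coords unfolding bij_betw_def inj_on_def by blast

lemma block_in_index: "x \<in> X \<Longrightarrow> b x \<in> I"
  using bij_coords unfolding bij_betw_def by blast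

lemma obtain_coords:
  assumes "i \<in> I" "j \<le> Suc (a i)"
  obtains x where "x \<in> X" "b x = i" "h x = j"
proof -
  have "(i, j) \<in> (\<lambda>x. (b x, h x)) ` X"
    using assms bij_coords unfolding bij_betw_def by auto
  then show thesis using that by auto
qed

lemma finite_carrier: "finite X"
  using bij_betw_finite[OF bij_coords] finite_index by auto

lemma card_carrier: "card X = 2 * card I + (\<Sum>i\<in>I. a i)"
proof -
  have "card X = (\<Sum>i\<in>I. Suc (Suc (a i)))"
    using bij_betw_same_card[OF bij_coords] finite_index by (simp add: card_SigmaI)
  also have "\<dots> = (\<Sum>i\<in>I. 2 + a i)"
    by simp
  finally show ?thesis
    by (simp add: sum.distrib del: add_2_eq_Suc)
qed

lemma partial_order_on_order: "partial_order_on X order"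
  unfolding partial_order_on_def preorder_on_def
proof (intro conjI)
  show "order \<subseteq> X \<times> X" and "refl_on X order"
    by (auto simp: order_def refl_on_def)
  show "trans order"
    by (rule transI) (auto simp: order_def)
  show "antisym order"
    by (rule antisymI) (auto simp: order_def intro: coords_inject)
qed

text \<open>\<open>pred_on.chain\<close> compares by the reflexive closure of the relation; as
  \<open>order\<close> is already reflexive on \<open>X\<close>, the closure drops out.\<close>

lemma chain_iff:
  "pred_on.chain X (\<lambda>x y. (x, y) \<in> order) C \<longleftrightarrow>
     C \<subseteq> X \<and> (\<forall>x\<in>C. \<forall>y\<in>C. (x, y) \<in> order \<or> (y, x) \<in> order)"
proof -
  have "(x, x) \<in> order" if "x \<in> X" for x
    using that by (simp add: order_def)
  then show ?thesis
    unfolding pred_on.chain_def by (auto 0 4)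
qed

text \<open>Within one block, two selected elements are either both on the long chain or both at
  height 0, and then they coincide.\<close>

lemma chain_selection: "pred_on.chain X (\<lambda>x y. (x, y) \<in> order) (selection J)"
  unfolding chain_iff
proof (intro conjI ballI)
  show "selection J \<subseteq> X" by (auto simp: selection_def)
  fix x y assume "x \<in> selection J" "y \<in> selection J"
  then show "(x, y) \<in> order \<or> (y, x) \<in> order"
    by (cases "b x" "b y" rule: linorder_cases; cases "h x \<le> h y")
       (auto simp: selection_def order_def intro: coords_inject)
qed

text \<open>Take for \<open>J\<close> the blocks in which \<open>C\<close> meets the long chain: in
  such a block, comparability excludes the isolated point from \<open>C\<close>.\<close>

lemma chain_subset_selection:
  assumes "pred_on.chain X (\<lambda>x y. (x, y) \<in> order) C"
  obtains J where "J \<subseteq> I" "C \<subseteq> selection J"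
proof
  let ?J = "b ` {x \<in> C. 0 < h x}"
  have C: "C \<subseteq> X" "\<And>x y. x \<in> C \<Longrightarrow> y \<in> C \<Longrightarrow> (x, y) \<in> order \<or> (y, x) \<in> order"
    using assms unfolding chain_iff by auto
  show "?J \<subseteq> I" using C(1) block_in_index by auto
  show "C \<subseteq> selection ?J"
  proof
    fix x assume x: "x \<in> C"
    have "0 < h x" if "y \<in> C" "0 < h y" "b x = b y" for y
      using C(2)[OF x that(1)] that by (auto simp: order_def)
    then show "x \<in> selection ?J"
      using x C(1) by (auto simp: selection_def)
  qed
qed

text \<open>Selections form an antichain under inclusion. This gives both their maximality and the
  injectivity of \<open>selection\<close>.\<close>

lemma selection_subset_iff:
  assumes "J \<subseteq> I" "J' \<subseteq> I"
  shows "selection J \<subseteq> selection J' \<longleftrightarrow> J = J'"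
proof
  assume sub: "selection J \<subseteq> selection J'"
  have "i \<in> J \<longleftrightarrow> i \<in> J'" if i: "i \<in> I" for i
  proof -
    \<comment> \<open>One test element per block suffices: the bottom of the long chain (height 1)
      if \<open>i \<in> J\<close>, the isolated point (height 0) otherwise.\<close>
    obtain x where x: "x \<in> X" "b x = i" "h x = of_bool (i \<in> J)"
      by (rule obtain_coords[OF i, of "of_bool (i \<in> J)"]) auto
    then have "x \<in> selection J" by (auto simp: selection_def)
    then have "x \<in> selection J'" using sub by blast
    then show ?thesis using x by (auto simp: selection_def)
  qed
  then show "J = J'" using assms by blast
qed simp

text \<open>Every chain extends to a selection, so a maximal one is a selection; conversely, a chain
  properly above a selection would put it properly inside another selection.\<close>

lemma maxchains_eq: "{C. pred_on.maxchain X (\<lambda>x y. (x, y) \<in> order) C} = selection ` Pow I"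
proof (intro equalityI subsetI)
  fix C assume "C \<in> {C. pred_on.maxchain X (\<lambda>x y. (x, y) \<in> order) C}"
  then have chain: "pred_on.chain X (\<lambda>x y. (x, y) \<in> order) C"
    and max: "\<And>D. pred_on.chain X (\<lambda>x y. (x, y) \<in> order) D \<Longrightarrow> \<not> C \<subset> D"
    unfolding pred_on.maxchain_def by auto
  obtain J where "J \<subseteq> I" "C \<subseteq> selection J"
    using chain_subset_selection[OF chain] .
  then show "C \<in> selection ` Pow I"
    using max[OF chain_selection] by blast
next
  fix C assume "C \<in> selection ` Pow I"
  then obtain J where J: "J \<subseteq> I" "C = selection J" by auto
  have "\<not> selection J \<subset> D" if D: "pred_on.chain X (\<lambda>x y. (x, y) \<in> order) D" for D
  proof
    assume sub: "selection J \<subset> D"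
    obtain J' where J': "J' \<subseteq> I" "D \<subseteq> selection J'"
      using chain_subset_selection[OF D] .
    then have "J = J'"
      using sub selection_subset_iff[OF J(1) J'(1)] by blast
    then show False using sub J' by blast
  qed
  then show "C \<in> {C. pred_on.maxchain X (\<lambda>x y. (x, y) \<in> order) C}"
    using J chain_selection unfolding pred_on.maxchain_def by auto
qed

lemma card_selection:
  assumes "J \<subseteq> I"
  shows "card (selection J) = card I + (\<Sum>i\<in>J. a i)"
proof -
  \<comment> \<open>\<open>?B i\<close> holds the heights selected in block \<open>i\<close>; its
    size is 1, plus \<open>a i\<close> when \<open>i \<in> J\<close>.\<close>
  let ?B = "\<lambda>i. if i \<in> J then {1..Suc (a i)} else {0}"
  have "(\<lambda>x. (b x, h x)) ` selection J = (SIGMA i:I. ?B i)"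
  proof (intro equalityI subsetI)
    fix p assume "p \<in> (\<lambda>x. (b x, h x)) ` selection J"
    then obtain x where x: "x \<in> selection J" "p = (b x, h x)" by auto
    then have "(b x, h x) \<in> (SIGMA i:I. {..Suc (a i)})"
      using bij_coords unfolding bij_betw_def selection_def by blast
    then show "p \<in> (SIGMA i:I. ?B i)"
      using x by (auto simp: selection_def)
  next
    fix p assume p: "p \<in> (SIGMA i:I. ?B i)"
    then obtain x where "x \<in> X" "b x = fst p" "h x = snd p"
      by (auto split: if_splits elim: obtain_coords)
    then show "p \<in> (\<lambda>x. (b x, h x)) ` selection J"
      using p by (intro image_eqI[of _ _ x]) (auto simp: selection_def split: if_splits)
  qed
  moreover have "inj_on (\<lambda>x. (b x, h x)) (selection J)"
    by (auto simp: inj_on_def selection_def intro: coords_inject)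
  ultimately have "card (selection J) = card (SIGMA i:I. ?B i)"
    by (metis card_image)
  also have "\<dots> = (\<Sum>i\<in>I. card (?B i))"
    using finite_index by (intro card_SigmaI) auto
  also have "\<dots> = (\<Sum>i\<in>I. 1 + (if i \<in> J then a i else 0))"
    by (intro sum.cong) auto
  also have "\<dots> = card I + (\<Sum>i\<in>I \<inter> J. a i)"
    using finite_index by (simp only: sum.distrib sum.inter_restrict card_eq_sum)
  also have "I \<inter> J = J" using assms by blast
  finally show ?thesis .
qed

lemma maxchain_cards_order:
  "maxchain_cards X order = image_mset (\<lambda>s. card I + s) (subset_sums I a)"
proof -
  \<comment> \<open>Injectivity yields one multiset entry for each \<open>J\<close>, so coinciding
    subset sums keep their multiplicity.\<close>
  have "inj_on selection (Pow I)"
    by (intro inj_onI) (metis PowD order_refl selection_subset_iff)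
  then have "maxchain_cards X order = image_mset (\<lambda>J. card (selection J)) (mset_set (Pow I))"
    unfolding maxchain_cards_def maxchains_eq
    by (simp add: image_mset_mset_set[symmetric] multiset.map_comp comp_def)
  also have "\<dots> = image_mset (\<lambda>J. card I + (\<Sum>i\<in>J. a i)) (mset_set (Pow I))"
    using finite_index by (intro image_mset_cong) (auto simp: card_selection)
  finally show ?thesis
    by (simp add: subset_sums_def multiset.map_comp comp_def)
qed

end

lemma size_subset_sums: "finite I \<Longrightarrow> size (subset_sums I a) = 2 ^ card I"
  by (simp add: subset_sums_def card_Pow)

lemma Max_shifted_subset_sums:
  assumes "finite I"
  shows "Max (set_mset (image_mset (\<lambda>x. c + x) (subset_sums I a))) = c + (\<Sum>i\<in>I. a i)"
proof (rule Max_eqI)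
  fix y assume "y \<in># image_mset (\<lambda>x. c + x) (subset_sums I a)"
  then obtain J where "J \<subseteq> I" "y = c + (\<Sum>i\<in>J. a i)"
    using assms by (auto simp: subset_sums_def)
  then show "y \<le> c + (\<Sum>i\<in>I. a i)"
    using assms by (simp add: sum_mono2)
qed (use assms in \<open>auto simp: subset_sums_def\<close>)

theorem theorem2:
  fixes k n m :: nat and a :: "nat \<Rightarrow> nat" and S :: "nat multiset"
  assumes "k \<ge> 1"
    and S: "S = image_mset (\<lambda>x. k + x) (subset_sums {1..k} a)"
    and n: "n = size S"
    and m: "m = Max (set_mset S)"
  shows "size (subset_sums {1..k} a) = 2 ^ k
    \<and> n = 2 ^ k
    \<and> m = k + (\<Sum>i=1..k. a i)
    \<and> real m + log 2 (real n) = real (2 * k + (\<Sum>i=1..k. a i))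
    \<and> (\<exists>(X :: nat set) r. finite X \<and> partial_order_on X r
         \<and> real (card X) = real m + log 2 (real n)
         \<and> maxchain_cards X r = S)"
proof -
  have size: "size (subset_sums {1..k} a) = 2 ^ k"
    by (simp add: size_subset_sums)
  have n_eq: "n = 2 ^ k"
    using n S size by simp
  have m_eq: "m = k + (\<Sum>i=1..k. a i)"
    unfolding m S by (rule Max_shifted_subset_sums) simp
  have total: "real m + log 2 (real n) = real (2 * k + (\<Sum>i=1..k. a i))"
    unfolding n_eq m_eq by (simp add: log_nat_power)
  \<comment> \<open>The pairs of block and height are coded as natural numbers to get a carrier of
    type \<open>nat set\<close>; \<open>prod_decode\<close> recovers the coordinates.\<close>
  define X where "X = prod_encode ` (SIGMA i:{1..k}. {..Suc (a i)})"
  interpret block_sum X "{1..k}" a "fst \<circ> prod_decode" "snd \<circ> prod_decode"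
  proof
    show "bij_betw (\<lambda>x. ((fst \<circ> prod_decode) x, (snd \<circ> prod_decode) x)) X
        (SIGMA i:{1..k}. {..Suc (a i)})"
      unfolding X_def by (rule bij_betw_byWitness[where f' = prod_encode]) auto
  qed simp
  have "finite X \<and> partial_order_on X order \<and> real (card X) = real m + log 2 (real n)
      \<and> maxchain_cards X order = S"
    using finite_carrier partial_order_on_order card_carrier maxchain_cards_order total S
    by simp
  then show ?thesis
    using size n_eq m_eq total by blast
qed

end
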